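(* Let $(\Lambda,\mathbf F,\omega)$ be a continuous $g$-fusion frame for $\mathcal H$, let $X_1\subset X$ be measurable, and put $X_1^c=X\setminus X_1$. Then for every $f\in\mathcal H$, $$\int_{X_1}\omega^2(x)\langle\tilde\Lambda_x\pi_{\tilde F(x)}f,\Lambda_x\pi_{F(x)}f\rangle\,d\mu(x)-\|S_{\mathbf F,\Lambda}^{X_1}f\|^2=\int_{X_1^c}\omega^2(x)\overline{\langle\tilde\Lambda_x\pi_{\tilde F(x)}f,\Lambda_x\pi_{F(x)}f\rangle}\,d\mu(x)-\|S_{\mathbf F,\Lambda}^{X_1^c}f\|^2 .$$
   Context: $\mathcal H$ is a Hilbert space; $\pi_V$ is the orthogonal projection of $\mathcal H$ onto a closed subspace $V$. $(X,\mu)$ is a measure space and $\omega:X\to[0,\infty)$ is measurable with $\omega\neq0$ a.e. $\mathbf F$ assigns to each $x\in X$ a closed subspace $F(x)\subseteq\mathcal H$ such that $x\mapsto\pi_{F(x)}f$ is weakly measurable for each $f\in\mathcal H$. $\{\mathcal H_x\}_{x\in X}$ is a family of Hilbert spaces, $\Lambda=\{\Lambda_x\}_{x\in X}$ with $\Lambda_x$ a bounded linear operator $F(x)\to\mathcal H_x$, and $x\mapsto\|\Lambda_x\pi_{F(x)}f\|^2$ is measurable for each $f$. $(\Lambda,\mathbf F,\omega)$ is a continuous $g$-fusion frame (continuous generalized fusion frame) for $\mathcal H$ if there are $0<A\le B<\infty$ with $A\|f\|^2\le\int_X\omega^2(x)\|\Lambda_x\pi_{F(x)}f\|^2d\mu(x)\le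 B\|f\|^2$ for all $f\in\mathcal H$. Vector-valued integrals are understood weakly. The frame operator $S_{\mathbf F,\Lambda}f=\int_X\omega^2(x)\pi_{F(x)}\Lambda_x^*\Lambda_x\pi_{F(x)}f\,d\mu(x)$ is bounded, positive, self-adjoint and invertible. Put $\tilde F(x)=S_{\mathbf F,\Lambda}^{-1}F(x)$ and $\tilde\Lambda_x=\Lambda_x\pi_{F(x)}S_{\mathbf F,\Lambda}^{-1}$. For measurable $Y\subset X$, $S_{\mathbf F,\Lambda}^{Y}f=\int_Y\omega^2(x)\pi_{F(x)}\Lambda_x^*\tilde\Lambda_x\pi_{\tilde F(x)}f\,d\mu(x)$. *)

theory Defs
  imports "HOL-Analysis.Analysis" "HOL-Algebra.Module"
begin

section \<open>Complex Hilbert spaces\<close>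

text \<open>
  Inner products are linear in the first argument. The ambient space is a type of the class below:
  a complete real inner product space (so that its norm, topology and completeness are the
  library's) with a complex structure and a complex inner product whose real part is
  the real inner product.
\<close>

class chilbert_space = real_inner + complete_space +
  fixes scaleC :: "complex \<Rightarrow> 'a \<Rightarrow> 'a" (infixr \<open>*\<^sub>C\<close> 75)
    and cinner :: "'a \<Rightarrow> 'a \<Rightarrow> complex"
  assumes scaleC_add_right: "a *\<^sub>C (u + v) = a *\<^sub>C u + a *\<^sub>C v"
    and scaleC_add_left: "(a + b) *\<^sub>C u = a *\<^sub>C u + b *\<^sub>C u"
    and scaleC_scaleC: "a *\<^sub>C (b *\<^sub>C u) = (a * b) *\<^sub>C u"
    and scaleC_of_real: "complex_of_real r *\<^sub>C u = r *\<^sub>R u"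
    and cinner_add_left: "cinner (u + v) w = cinner u w + cinner v w"
    and cinner_scaleC_left: "cinner (a *\<^sub>C u) v = a * cinner u v"
    and cinner_commute: "cinner v u = cnj (cinner u v)"
    and Re_cinner: "Re (cinner u v) = inner u v"

instantiation complex :: chilbert_space
begin
definition "scaleC_complex = ((*) :: complex \<Rightarrow> complex \<Rightarrow> complex)"
definition "cinner_complex u v = u * cnj v" for u v :: complex
instance
  by standard
    (auto simp: scaleC_complex_def cinner_complex_def algebra_simps scaleR_conv_of_real
      inner_complex_def)
end

definition closed_csubspace :: "'h::chilbert_space set \<Rightarrow> bool" where
  "closed_csubspace V \<longleftrightarrow> module.subspace scaleC V \<and> closed V"

definition cproj :: "'h::chilbert_space set \<Rightarrow> 'h \<Rightarrow> 'h" where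
  "cproj V f = (THE v. v \<in> V \<and> (\<forall>w\<in>V. cinner (f - v) w = 0))"

text \<open>
  A type cannot depend on the point \<open>x\<close>, so the members of a family of Hilbert spaces
  \<open>H x\<close> are structures with explicit carriers in a common type: modules over the complex field
  in the sense of HOL-Algebra, with an additional inner product. Different members
  need not be related to each other. The multiplication and unit that the
  module record inherits from the ring record are unused.
\<close>

definition complex_field :: "complex ring" where
  "complex_field = \<lparr>carrier = UNIV, mult = (*), one = 1, zero = 0, add = (+)\<rparr>"

record 'k ip_space = "(complex, 'k) module" +
  ip :: "'k \<Rightarrow> 'k \<Rightarrow> complex"

definition ip_norm :: "('k, 'm) ip_space_scheme \<Rightarrow> 'k \<Rightarrow> real" where
  "ip_norm K u = sqrt (Re (ip K u u))"

locale complex_hilbert_space = Module.module complex_field K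
  for K :: "('k, 'm) ip_space_scheme" (structure) +
  assumes ip_add_left:
      "\<lbrakk>u \<in> carrier K; v \<in> carrier K; w \<in> carrier K\<rbrakk> \<Longrightarrow> ip K (u \<oplus> v) w = ip K u w + ip K v w"
    and ip_smult_left:
      "\<lbrakk>u \<in> carrier K; v \<in> carrier K\<rbrakk> \<Longrightarrow> ip K (a \<odot>\<^bsub>K\<^esub> u) v = a * ip K u v"
    and ip_commute:
      "\<lbrakk>u \<in> carrier K; v \<in> carrier K\<rbrakk> \<Longrightarrow> ip K v u = cnj (ip K u v)"
    and ip_pos:
      "\<lbrakk>u \<in> carrier K; u \<noteq> \<zero>\<^bsub>K\<^esub>\<rbrakk> \<Longrightarrow> 0 < Re (ip K u u)"
    and complete:
      "Metric_space.mcomplete (carrier K) (\<lambda>u v. ip_norm K (u \<ominus>\<^bsub>K\<^esub> v))"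

text \<open>Bounded operators defined on a subspace \<open>V\<close>; values outside \<open>V\<close> are irrelevant.\<close>

definition bounded_operator_on ::
    "'h::chilbert_space set \<Rightarrow> ('k, 'm) ip_space_scheme \<Rightarrow> ('h \<Rightarrow> 'k) \<Rightarrow> bool" where
  "bounded_operator_on V K T \<longleftrightarrow>
     T \<in> V \<rightarrow> carrier K \<and>
     (\<forall>u\<in>V. \<forall>v\<in>V. T (u + v) = T u \<oplus>\<^bsub>K\<^esub> T v) \<and>
     (\<forall>a. \<forall>u\<in>V. T (a *\<^sub>C u) = a \<odot>\<^bsub>K\<^esub> T u) \<and>
     (\<exists>C. \<forall>u\<in>V. ip_norm K (T u) \<le> C * norm u)"

definition adjoint_on ::
    "'h::chilbert_space set \<Rightarrow> ('k, 'm) ip_space_scheme \<Rightarrow> ('h \<Rightarrow> 'k) \<Rightarrow> 'k \<Rightarrow> 'h" where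
  "adjoint_on V K T y = (THE u. u \<in> V \<and> (\<forall>w\<in>V. ip K (T w) y = cinner w u))"

section \<open>Weak vector-valued integrals\<close>

definition has_weak_integral ::
    "'x measure \<Rightarrow> 'x set \<Rightarrow> ('x \<Rightarrow> 'h::chilbert_space) \<Rightarrow> 'h \<Rightarrow> bool" where
  "has_weak_integral M Y u v \<longleftrightarrow>
     (\<forall>g. set_integrable M Y (\<lambda>x. cinner (u x) g) \<and>
          (LINT x:Y|M. cinner (u x) g) = cinner v g)"

definition weak_integral ::
    "'x measure \<Rightarrow> 'x set \<Rightarrow> ('x \<Rightarrow> 'h::chilbert_space) \<Rightarrow> 'h" where
  "weak_integral M Y u = (THE v. has_weak_integral M Y u v)"

section \<open>Continuous g-fusion frames\<close>

locale continuous_g_fusion_frame =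
  fixes M :: "'x measure"
    and \<omega> :: "'x \<Rightarrow> real"
    and F :: "'x \<Rightarrow> 'h::chilbert_space set"
    and H :: "'x \<Rightarrow> ('k, 'm) ip_space_scheme"
    and \<Lambda> :: "'x \<Rightarrow> 'h \<Rightarrow> 'k"
  assumes weight_measurable: "\<omega> \<in> borel_measurable M"
    and weight_nonneg: "x \<in> space M \<Longrightarrow> 0 \<le> \<omega> x"
    and weight_nonzero: "AE x in M. \<omega> x \<noteq> 0"
    and closed_csubspace: "x \<in> space M \<Longrightarrow> closed_csubspace (F x)"
    and proj_weakly_measurable: "(\<lambda>x. cinner (cproj (F x) f) g) \<in> borel_measurable M"
    and hilbert: "x \<in> space M \<Longrightarrow> complex_hilbert_space (H x)"
    and bounded_operator: "x \<in> space M \<Longrightarrow> bounded_operator_on (F x) (H x) (\<Lambda> x)"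
    and norm_measurable:
      "(\<lambda>x. (ip_norm (H x) (\<Lambda> x (cproj (F x) f)))\<^sup>2) \<in> borel_measurable M"
    and frame_bounds:
      "\<exists>A B. 0 < A \<and> A \<le> B \<and>
         (\<forall>f. ennreal (A * (norm f)\<^sup>2)
                \<le> (\<integral>\<^sup>+x. ennreal ((\<omega> x)\<^sup>2 * (ip_norm (H x) (\<Lambda> x (cproj (F x) f)))\<^sup>2) \<partial>M) \<and>
              (\<integral>\<^sup>+x. ennreal ((\<omega> x)\<^sup>2 * (ip_norm (H x) (\<Lambda> x (cproj (F x) f)))\<^sup>2) \<partial>M)
                \<le> ennreal (B * (norm f)\<^sup>2))"

definition frame_operator ::
    "'x measure \<Rightarrow> ('x \<Rightarrow> real) \<Rightarrow> ('x \<Rightarrow> 'h::chilbert_space set) \<Rightarrow>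
     ('x \<Rightarrow> ('k, 'm) ip_space_scheme) \<Rightarrow> ('x \<Rightarrow> 'h \<Rightarrow> 'k) \<Rightarrow> 'h \<Rightarrow> 'h" where
  "frame_operator M \<omega> F H \<Lambda> f =
     weak_integral M (space M)
       (\<lambda>x. (\<omega> x)\<^sup>2 *\<^sub>R cproj (F x) (adjoint_on (F x) (H x) (\<Lambda> x) (\<Lambda> x (cproj (F x) f))))"

text \<open>Loading HOL-Algebra reserves \<open>inv\<close> for group inverses, hence \<open>inv_into UNIV\<close>.\<close>

definition frame_operator_inv ::
    "'x measure \<Rightarrow> ('x \<Rightarrow> real) \<Rightarrow> ('x \<Rightarrow> 'h::chilbert_space set) \<Rightarrow>
     ('x \<Rightarrow> ('k, 'm) ip_space_scheme) \<Rightarrow> ('x \<Rightarrow> 'h \<Rightarrow> 'k) \<Rightarrow> 'h \<Rightarrow> 'h" where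
  "frame_operator_inv M \<omega> F H \<Lambda> = inv_into UNIV (frame_operator M \<omega> F H \<Lambda>)"

definition dual_subspace ::
    "'x measure \<Rightarrow> ('x \<Rightarrow> real) \<Rightarrow> ('x \<Rightarrow> 'h::chilbert_space set) \<Rightarrow>
     ('x \<Rightarrow> ('k, 'm) ip_space_scheme) \<Rightarrow> ('x \<Rightarrow> 'h \<Rightarrow> 'k) \<Rightarrow> 'x \<Rightarrow> 'h set" where
  "dual_subspace M \<omega> F H \<Lambda> x = frame_operator_inv M \<omega> F H \<Lambda> ` F x"

definition dual_operator ::
    "'x measure \<Rightarrow> ('x \<Rightarrow> real) \<Rightarrow> ('x \<Rightarrow> 'h::chilbert_space set) \<Rightarrow>
     ('x \<Rightarrow> ('k, 'm) ip_space_scheme) \<Rightarrow> ('x \<Rightarrow> 'h \<Rightarrow> 'k) \<Rightarrow> 'x \<Rightarrow> 'h \<Rightarrow> 'k" where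
  "dual_operator M \<omega> F H \<Lambda> x u = \<Lambda> x (cproj (F x) (frame_operator_inv M \<omega> F H \<Lambda> u))"

definition partial_frame_operator ::
    "'x measure \<Rightarrow> ('x \<Rightarrow> real) \<Rightarrow> ('x \<Rightarrow> 'h::chilbert_space set) \<Rightarrow>
     ('x \<Rightarrow> ('k, 'm) ip_space_scheme) \<Rightarrow> ('x \<Rightarrow> 'h \<Rightarrow> 'k) \<Rightarrow> 'x set \<Rightarrow> 'h \<Rightarrow> 'h" where
  "partial_frame_operator M \<omega> F H \<Lambda> Y f =
     weak_integral M Y
       (\<lambda>x. (\<omega> x)\<^sup>2 *\<^sub>R cproj (F x) (adjoint_on (F x) (H x) (\<Lambda> x)
          (dual_operator M \<omega> F H \<Lambda> x (cproj (dual_subspace M \<omega> F H \<Lambda> x) f))))"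

end

theory Submission
  imports Defs
begin

text \<open>
  Write \<open>S\<close> for the frame operator and \<open>S\<^sub>Y\<close> for its restriction to \<open>Y\<close>, so that
  \<open>\<langle>S\<^sub>Y u, v\<rangle>\<close> is the integral over \<open>Y\<close> of \<open>\<omega>\<^sup>2 \<langle>\<Lambda> \<pi> u, \<Lambda> \<pi> v\<rangle>\<close>. Since
  \<open>S\<^sup>-\<^sup>1\<close> is self-adjoint, \<open>\<pi> S\<^sup>-\<^sup>1 \<pi>' = \<pi> S\<^sup>-\<^sup>1\<close>, where \<open>\<pi>\<close> and \<open>\<pi>'\<close> project onto
  \<open>F x\<close> and \<open>S\<^sup>-\<^sup>1 F x\<close>. Hence the partial frame operator of \<open>Y\<close> is \<open>P = S\<^sub>Y S\<^sup>-\<^sup>1\<close>, that of the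
  complement is \<open>Q = I - P\<close>, and the claim is the identity
  \<open>\<langle>P f, f\<rangle> - \<langle>P f, P f\<rangle> = \<langle>P f, Q f\<rangle> = \<langle>f, Q f\<rangle> - \<langle>Q f, Q f\<rangle>\<close>.
  Measurability of the sesquilinear integrand comes from polarization, existence of the weak
  integrals from the Riesz theorem, and invertibility of \<open>S\<close> from the lower frame bound.
\<close>

section \<open>Complex inner products\<close>

lemma module_scaleC: "Modules.module (scaleC :: complex \<Rightarrow> 'h::chilbert_space \<Rightarrow> 'h)"
proof
  show "(1::complex) *\<^sub>C x = x" for x :: 'h
    using scaleC_of_real[of 1 x] by simp
qed (simp_all add: scaleC_add_right scaleC_add_left scaleC_scaleC)

lemmas csubspace_def = Modules.module.subspace_def[OF module_scaleC]

lemma cinner_add_right: "cinner u (v + w) = cinner u v + cinner u w"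
  by (metis cinner_commute cinner_add_left complex_cnj_add)

lemma scaleR_scaleC: "r *\<^sub>R u = complex_of_real r *\<^sub>C u"
  by (simp add: scaleC_of_real)

lemma cinner_scaleR_left: "cinner (r *\<^sub>R u) v = complex_of_real r * cinner u v"
  by (simp add: scaleR_scaleC cinner_scaleC_left)

lemma cinner_minus_left: "cinner (- u) v = - cinner u v"
  using cinner_scaleR_left[of "-1" u v] by simp

lemma cinner_diff_left: "cinner (u - v) w = cinner u w - cinner v w"
  using cinner_add_left[of u "- v" w] by (simp add: cinner_minus_left)

lemma cinner_diff_right: "cinner w (u - v) = cinner w u - cinner w v"
  by (metis cinner_commute cinner_diff_left complex_cnj_diff)

lemma cinner_zero_left: "cinner 0 v = 0"
  using cinner_scaleR_left[of 0 0 v] by simp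

lemma cinner_self: "cinner u u = complex_of_real ((norm u)\<^sup>2)"
proof -
  have "Im (cinner u u) = 0"
    using arg_cong[OF cinner_commute[of u u], of Im] by simp
  then show ?thesis
    by (simp add: complex_eq_iff Re_cinner power2_norm_eq_inner)
qed

lemma cinner_eqI:
  assumes "\<And>g. cinner u g = cinner v g"
  shows "u = v"
proof -
  have "cinner (u - v) (u - v) = 0"
    by (simp add: cinner_diff_left assms)
  then show ?thesis
    by (simp add: cinner_self)
qed

text \<open>Multiplying by \<open>\<i>\<close> moves the imaginary part into the real one, so the
  real inner product alone determines \<open>cinner\<close>. This carries the Riesz theorem from
  real to complex scalars.\<close>

lemma Im_cinner: "Im (cinner u v) = - inner (\<i> *\<^sub>C u) v"
  by (simp flip: Re_cinner add: cinner_scaleC_left)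

text \<open>One interface serves the inner product, the fibre forms, the pointwise integrand and its
  integrals. Semidefinite is the natural generality: a fibre form vanishes on vectors orthogonal to
  \<open>F x\<close>.\<close>

locale psd_form =
  fixes G :: "'h::chilbert_space \<Rightarrow> 'h \<Rightarrow> complex"
  assumes add_left: "G (u + v) w = G u w + G v w"
    and scale_left: "G (a *\<^sub>C u) v = a * G u v"
    and commute: "G v u = cnj (G u v)"
    and nonneg: "0 \<le> Re (G u u)"
begin

lemma add_right: "G u (v + w) = G u v + G u w"
  by (metis commute add_left complex_cnj_add)

lemma scale_right: "G u (a *\<^sub>C v) = cnj a * G u v"
  by (metis commute scale_left complex_cnj_mult)

lemma Re_expand:
  "Re (G (u + a *\<^sub>C v) (u + a *\<^sub>C v)) =
    Re (G u u) + 2 * Re (cnj a * G u v) + (cmod a)\<^sup>2 * Re (G v v)"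
proof -
  have "G (u + a *\<^sub>C v) (u + a *\<^sub>C v)
      = G u u + (cnj a * G u v + cnj (cnj a * G u v)) + (a * cnj a) * G v v"
    by (simp add: add_left add_right scale_left scale_right commute[of v u] algebra_simps)
  then show ?thesis
    by (simp add: complex_add_cnj flip: complex_norm_square)
qed

lemma cauchy_schwarz: "(cmod (G u v))\<^sup>2 \<le> Re (G u u) * Re (G v v)"
proof -
  define g where "g = (cmod (G u v))\<^sup>2"
  \<comment> \<open>The form is evaluated at \<open>u - t * G u v *\<^sub>C v\<close>. The factor
    \<open>G u v\<close> aligns the phase, so that the cross term is real.\<close>
  have *: "0 \<le> Re (G u u) - 2 * t * g + t\<^sup>2 * g * Re (G v v)" for t
  proof -
    have "Re (cnj (- complex_of_real t * G u v) * G u v) = - t * g"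
      unfolding g_def cmod_power2 by (simp add: power2_eq_square algebra_simps)
    then show ?thesis
      using nonneg[of "u + (- complex_of_real t * G u v) *\<^sub>C v"]
      unfolding Re_expand by (simp add: norm_mult power_mult_distrib g_def)
  qed
  show ?thesis
  proof (cases "Re (G v v) = 0")
    case True
    \<comment> \<open>Here the polynomial in \<open>t\<close> is affine with slope
      \<open>- 2 * g\<close>. For \<open>g\<close> nonzero the chosen \<open>t\<close> gives it the
      value \<open>-1\<close>.\<close>
    have "g = 0"
    proof (rule ccontr)
      assume "g \<noteq> 0"
      then have "2 * ((Re (G u u) + 1) / (2 * g)) * g = Re (G u u) + 1"
        by simp
      then show False
        using *[of "(Re (G u u) + 1) / (2 * g)"] True by simp
    qed
    then show ?thesis
      using True by (simp add: g_def)
  next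
    case False
    then have pos: "0 < Re (G v v)"
      using nonneg[of v] by simp
    then have "(1 / Re (G v v))\<^sup>2 * g * Re (G v v) = g / Re (G v v)"
      by (simp add: power2_eq_square)
    \<comment> \<open>\<open>t = 1 / Re (G v v)\<close> is the minimizer of the quadratic.\<close>
    then have "g / Re (G v v) \<le> Re (G u u)"
      using *[of "1 / Re (G v v)"] by simp
    then show ?thesis
      using pos by (simp add: pos_divide_le_eq g_def)
  qed
qed

text \<open>The cross terms for the four fourth roots of unity recover \<open>G u v\<close> from
  diagonal values, whose integrability the frame condition controls. The coefficients
  \<open>1\<close> and \<open>-1\<close> stay explicit so that \<open>Re_expand\<close> applies to
  all four terms.\<close>

lemma polarization:
  "G u v =
    (complex_of_real (Re (G (u + 1 *\<^sub>C v) (u + 1 *\<^sub>C v)))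
      - complex_of_real (Re (G (u + (-1) *\<^sub>C v) (u + (-1) *\<^sub>C v)))
      + \<i> * complex_of_real (Re (G (u + \<i> *\<^sub>C v) (u + \<i> *\<^sub>C v)))
      - \<i> * complex_of_real (Re (G (u + (-\<i>) *\<^sub>C v) (u + (-\<i>) *\<^sub>C v)))) / 4"
  unfolding Re_expand by (simp add: complex_eq_iff)

end

interpretation cinner: psd_form cinner
  by standard (simp_all add: cinner_add_left cinner_scaleC_left cinner_self cinner_commute[symmetric])

lemma cmod_cinner_le: "cmod (cinner u v) \<le> norm u * norm v"
  by (rule power2_le_imp_le)
    (use cinner.cauchy_schwarz[of u v] in \<open>simp_all add: cinner_self power_mult_distrib\<close>)

section \<open>The Riesz representation theorem and projections\<close>

text \<open>
  The representing vector minimizes \<open>J w = \<parallel>w\<parallel>\<^sup>2 - 2 \<phi> w\<close>; by the parallelogram law every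
  minimizing sequence is Cauchy.
\<close>

lemma riesz_real_subspace:
  fixes V :: "'a::{real_inner, complete_space} set"
  assumes V: "subspace V" "closed V"
    and add: "\<And>u v. u \<in> V \<Longrightarrow> v \<in> V \<Longrightarrow> \<phi> (u + v) = \<phi> u + \<phi> v"
    and scale: "\<And>r u. u \<in> V \<Longrightarrow> \<phi> (r *\<^sub>R u) = r * \<phi> u"
    and bound: "\<And>u. u \<in> V \<Longrightarrow> \<bar>\<phi> u\<bar> \<le> C * norm u"
  obtains u where "u \<in> V" "\<And>w. w \<in> V \<Longrightarrow> \<phi> w = inner w u"
proof -
  define J where "J w = inner w w - 2 * \<phi> w" for w
  define m where "m = Inf (J ` V)"
  have lower: "- C\<^sup>2 \<le> J w" if "w \<in> V" for w
  proof -
    \<comment> \<open>Completing the square: \<open>\<phi> w\<close> is at most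
      \<open>C * norm w\<close>, so \<open>J w\<close> is at least
      \<open>(norm w - C)\<^sup>2 - C\<^sup>2\<close>.\<close>
    have "0 \<le> (norm w - C)\<^sup>2"
      by simp
    then show ?thesis
      using bound[OF that] by (simp add: J_def power2_diff mult.commute flip: power2_norm_eq_inner)
  qed
  then have bdd: "bdd_below (J ` V)"
    by (auto intro!: bdd_belowI2)
  have V0: "0 \<in> V"
    using V(1) by (rule subspace_0)
  have m_le: "m \<le> J w" if "w \<in> V" for w
    unfolding m_def by (rule cINF_lower[OF bdd that])
  have "\<exists>w\<in>V. J w < m + inverse (real (Suc n))" for n
  proof -
    have "Inf (J ` V) < m + inverse (real (Suc n))"
      by (simp add: m_def)
    then show ?thesis
      using V0 bdd by (subst (asm) cInf_less_iff) auto
  qed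
  then obtain w where wV: "\<And>n. w n \<in> V" and wJ: "\<And>n. J (w n) < m + inverse (real (Suc n))"
    by metis
  have diff_le: "(norm (u - v))\<^sup>2 \<le> 2 * (J u - m) + 2 * (J v - m)" if "u \<in> V" "v \<in> V" for u v
  proof -
    \<comment> \<open>The midpoint stays in \<open>V\<close>, so \<open>m \<le> J h\<close>. In
      \<open>2 * J u + 2 * J v - 4 * J h\<close> the linear terms cancel and the parallelogram law
      remains.\<close>
    define h where "h = (1/2) *\<^sub>R (u + v)"
    have hV: "h \<in> V"
      unfolding h_def using V(1) that by (simp add: subspace_add subspace_scale)
    have "\<phi> h = (\<phi> u + \<phi> v) / 2"
      unfolding h_def using V(1) that by (simp add: scale add subspace_add)
    then have "(norm (u - v))\<^sup>2 = 2 * J u + 2 * J v - 4 * J h"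
      unfolding power2_norm_eq_inner J_def
      by (simp add: h_def inner_simps inner_commute algebra_simps)
    then show ?thesis
      using m_le[OF hV] by simp
  qed
  have "Cauchy w"
  proof (rule metric_CauchyI)
    fix e :: real assume e: "0 < e"
    \<comment> \<open>\<open>diff_le\<close> doubles two excesses over \<open>m\<close>, so
      \<open>e\<^sup>2 / 4\<close> for each adds up to \<open>e\<^sup>2\<close>.\<close>
    obtain N where N: "inverse (real (Suc N)) < e\<^sup>2 / 4"
      using reals_Archimedean[of "e\<^sup>2 / 4"] e by auto
    have small: "J (w n) - m < e\<^sup>2 / 4" if "n \<ge> N" for n
    proof -
      have "inverse (real (Suc n)) \<le> inverse (real (Suc N))"
        using that by (simp add: field_simps)
      then show ?thesis
        using wJ[of n] N by linarith
    qed
    have "dist (w i) (w j) < e" if "i \<ge> N" "j \<ge> N" for i j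
    proof -
      have "(norm (w i - w j))\<^sup>2 < e\<^sup>2"
        using diff_le[OF wV wV, of i j] small[OF that(1)] small[OF that(2)] by argo
      then show ?thesis
        using e by (simp add: dist_norm power_less_imp_less_base)
    qed
    then show "\<exists>N. \<forall>i\<ge>N. \<forall>j\<ge>N. dist (w i) (w j) < e"
      by blast
  qed
  then obtain u where lim: "w \<longlonglongrightarrow> u"
    using Cauchy_convergent_iff convergent_def by blast
  have uV: "u \<in> V"
    using V(2) wV lim closed_sequentially by blast
  have "(\<lambda>n. \<phi> (w n)) \<longlonglongrightarrow> \<phi> u"
  proof (rule Lim_null_comparison[THEN LIM_zero_cancel])
    have "\<phi> (w n) - \<phi> u = \<phi> (w n - u)" for n
      using add[of "w n - u" u] wV uV V(1) by (simp add: subspace_diff)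
    then have "norm (\<phi> (w n) - \<phi> u) \<le> C * norm (w n - u)" for n
      using bound[of "w n - u"] wV uV V(1) by (simp add: subspace_diff)
    then show "\<forall>\<^sub>F n in sequentially. norm (\<phi> (w n) - \<phi> u) \<le> C * norm (w n - u)"
      by simp
    show "(\<lambda>n. C * norm (w n - u)) \<longlonglongrightarrow> 0"
      using lim by (auto intro!: tendsto_eq_intros simp: LIM_zero)
  qed
  then have "(\<lambda>n. J (w n)) \<longlonglongrightarrow> J u"
    unfolding J_def by (intro tendsto_intros lim)
  moreover have "(\<lambda>n. m + inverse (real (Suc n))) \<longlonglongrightarrow> m"
    using tendsto_add[OF tendsto_const LIMSEQ_inverse_real_of_nat, of m] by simp
  ultimately have "J u \<le> m"
    by (rule LIMSEQ_le) (use wJ less_imp_le in blast)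
  show thesis
  proof (rule that[OF uV])
    fix z assume z: "z \<in> V"
    \<comment> \<open>Up to a factor 2, \<open>d\<close> is the derivative of \<open>J\<close> at
      the minimizer \<open>u\<close> in direction \<open>z\<close>. A nonzero \<open>d\<close> would
      make the quadratic below negative, at \<open>t = - d\<close> if \<open>inner z z = 0\<close>
      and at its vertex otherwise.\<close>
    define d where "d = inner z u - \<phi> z"
    have quad: "0 \<le> t\<^sup>2 * inner z z + 2 * t * d" for t
    proof -
      have "\<phi> (u + t *\<^sub>R z) = \<phi> u + t * \<phi> z"
        using uV z V(1) by (simp add: add scale subspace_scale)
      then have "J (u + t *\<^sub>R z) = J u + (t\<^sup>2 * inner z z + 2 * t * d)"
        by (simp add: J_def d_def inner_simps inner_commute algebra_simps power2_eq_square)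
      moreover have "m \<le> J (u + t *\<^sub>R z)"
        using uV z V(1) by (intro m_le subspace_add subspace_scale)
      ultimately show ?thesis
        using \<open>J u \<le> m\<close> by linarith
    qed
    have "d = 0"
    proof (cases "inner z z = 0")
      case True
      then show ?thesis
        using quad[of "- d"] by simp (metis less_eq_real_def mult_eq_0_iff not_square_less_zero)
    next
      case False
      then have "0 < inner z z"
        by simp
      then have "d\<^sup>2 \<le> 0"
        using quad[of "- d / inner z z"] by (simp add: field_simps power2_eq_square)
      then show ?thesis
        by simp
    qed
    then show "\<phi> z = inner z u"
      by (simp add: d_def)
  qed
qed

section \<open>Closed complex subspaces and their orthogonal projections\<close>

lemma closed_csubspaceD:
  assumes "closed_csubspace V"
  shows closed_csubspace_zero: "0 \<in> V"
    and closed_csubspace_add: "u \<in> V \<Longrightarrow> v \<in> V \<Longrightarrow> u + v \<in> V"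
    and closed_csubspace_scaleC: "u \<in> V \<Longrightarrow> a *\<^sub>C u \<in> V"
    and closed_csubspace_closed: "closed V"
  using assms by (auto simp: closed_csubspace_def csubspace_def)

lemma closed_csubspace_subspace: "closed_csubspace V \<Longrightarrow> subspace V"
  by (auto simp: subspace_def closed_csubspaceD scaleR_scaleC)

lemma closed_csubspaceI:
  assumes "subspace V" "\<And>a u. u \<in> V \<Longrightarrow> a *\<^sub>C u \<in> V" "closed V"
  shows "closed_csubspace V"
  using assms by (auto simp: closed_csubspace_def csubspace_def subspace_def)

text \<open>The vector representing \<open>Re \<phi>\<close> for the real inner product also
  represents \<open>\<phi>\<close>: complex linearity determines the imaginary part from the real
  part at \<open>\<i> *\<^sub>C w\<close>.\<close>

lemma riesz_csubspace:
  fixes \<phi> :: "'h::chilbert_space \<Rightarrow> complex"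
  assumes V: "closed_csubspace V"
    and add: "\<And>u v. u \<in> V \<Longrightarrow> v \<in> V \<Longrightarrow> \<phi> (u + v) = \<phi> u + \<phi> v"
    and scale: "\<And>a u. u \<in> V \<Longrightarrow> \<phi> (a *\<^sub>C u) = a * \<phi> u"
    and bound: "\<And>u. u \<in> V \<Longrightarrow> cmod (\<phi> u) \<le> C * norm u"
  obtains u where "u \<in> V" "\<And>w. w \<in> V \<Longrightarrow> \<phi> w = cinner w u"
proof -
  have "\<bar>Re (\<phi> u)\<bar> \<le> C * norm u" if "u \<in> V" for u
    using abs_Re_le_cmod[of "\<phi> u"] bound[OF that] by linarith
  then obtain u where u: "u \<in> V" "\<And>w. w \<in> V \<Longrightarrow> Re (\<phi> w) = inner w u"
    using riesz_real_subspace[OF closed_csubspace_subspace[OF V] closed_csubspace_closed[OF V],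
        of "\<lambda>w. Re (\<phi> w)" C]
    by (auto simp: add scale scaleR_scaleC)
  show thesis
  proof (rule that[OF u(1)])
    fix w assume w: "w \<in> V"
    have "Im (\<phi> w) = - Re (\<phi> (\<i> *\<^sub>C w))"
      using w by (simp add: scale)
    then show "\<phi> w = cinner w u"
      using w u(2) closed_csubspace_scaleC[OF V w] by (simp add: complex_eq_iff Re_cinner Im_cinner)
  qed
qed

text \<open>The difference \<open>u - v\<close> is itself an admissible test vector. This gives
  uniqueness for the definite descriptions of projections and adjoints.\<close>

lemma csubspace_orthogonal_unique:
  assumes V: "closed_csubspace V" and "u \<in> V" "v \<in> V"
    and "\<And>w. w \<in> V \<Longrightarrow> cinner w u = cinner w v"
  shows "u = v"
proof -
  have "u - v \<in> V"
    using assms(2,3) closed_csubspace_subspace[OF V] by (simp add: subspace_diff)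
  then have "cinner (u - v) (u - v) = 0"
    using assms(4) by (simp add: cinner_diff_right)
  then show ?thesis
    by (simp add: cinner_self)
qed

text \<open>Existence comes from representing \<open>w \<mapsto> cinner w f\<close> on
  \<open>V\<close> by a vector of \<open>V\<close>; this justifies the definite description in
  \<open>cproj\<close>.\<close>

lemma cproj:
  assumes V: "closed_csubspace V"
  shows cproj_in: "cproj V f \<in> V"
    and cproj_orthogonal: "w \<in> V \<Longrightarrow> cinner (f - cproj V f) w = 0"
proof -
  obtain v where v: "v \<in> V" "\<And>w. w \<in> V \<Longrightarrow> cinner w f = cinner w v"
    by (rule riesz_csubspace[OF V, of "\<lambda>w. cinner w f" "norm f"])
      (use cmod_cinner_le in \<open>auto simp: cinner_add_left cinner_scaleC_left mult.commute\<close>)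
  have "cproj V f \<in> V \<and> (\<forall>w\<in>V. cinner (f - cproj V f) w = 0)"
    unfolding cproj_def
  proof (rule theI[where a = v])
    show "v \<in> V \<and> (\<forall>w\<in>V. cinner (f - v) w = 0)"
      using v by (metis cinner_commute cinner_diff_right complex_cnj_zero diff_self)
    show "u = v" if "u \<in> V \<and> (\<forall>w\<in>V. cinner (f - u) w = 0)" for u
      by (rule csubspace_orthogonal_unique[OF V])
        (use that v in \<open>auto, metis cinner_commute cinner_diff_right complex_cnj_zero
          right_minus_eq\<close>)
  qed
  then show "cproj V f \<in> V" "w \<in> V \<Longrightarrow> cinner (f - cproj V f) w = 0"
    by auto
qed

lemma cproj_unique:
  assumes V: "closed_csubspace V" and "v \<in> V" "\<And>w. w \<in> V \<Longrightarrow> cinner (f - v) w = 0"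
  shows "cproj V f = v"
proof (rule csubspace_orthogonal_unique[OF V])
  fix w assume w: "w \<in> V"
  have "cinner (cproj V f) w = cinner v w"
    using cproj_orthogonal[OF V w, of f] assms(3)[OF w] by (simp add: cinner_diff_left)
  then show "cinner w (cproj V f) = cinner w v"
    by (metis cinner_commute)
qed (use assms cproj_in in auto)

lemma cinner_cproj_left: "closed_csubspace V \<Longrightarrow> w \<in> V \<Longrightarrow> cinner (cproj V f) w = cinner f w"
  using cproj_orthogonal[of V w f] by (simp add: cinner_diff_left)

lemma cproj_add:
  assumes "closed_csubspace V"
  shows "cproj V (f + g) = cproj V f + cproj V g"
  by (rule cproj_unique[OF assms])
    (simp_all add: assms cproj_in closed_csubspace_add cinner_diff_left cinner_add_left
      cinner_cproj_left)

lemma cproj_scaleC: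
  assumes "closed_csubspace V"
  shows "cproj V (a *\<^sub>C f) = a *\<^sub>C cproj V f"
  by (rule cproj_unique[OF assms])
    (simp_all add: assms cproj_in closed_csubspace_scaleC cinner_diff_left cinner_scaleC_left
      cinner_cproj_left)

lemma cinner_cproj_commute:
  assumes "closed_csubspace V"
  shows "cinner (cproj V f) g = cinner f (cproj V g)"
proof -
  have "cinner (cproj V f) g = cnj (cinner g (cproj V f))"
    by (rule cinner_commute)
  also have "\<dots> = cinner (cproj V f) (cproj V g)"
    by (simp add: assms cproj_in flip: cinner_cproj_left[of V _ g] cinner_commute)
  also have "\<dots> = cinner f (cproj V g)"
    by (simp add: assms cproj_in cinner_cproj_left)
  finally show ?thesis .
qed

lemma norm_cproj_le:
  assumes V: "closed_csubspace V"
  shows "norm (cproj V f) \<le> norm f"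
proof -
  have "inner (f - cproj V f) (cproj V f) = 0"
    using cproj_orthogonal[OF V cproj_in[OF V]] by (simp flip: Re_cinner)
  then have "(norm (cproj V f))\<^sup>2 = inner f (cproj V f)"
    by (simp add: power2_norm_eq_inner inner_diff_left)
  also have "\<dots> \<le> norm f * norm (cproj V f)"
    by (rule norm_cauchy_schwarz)
  finally show ?thesis
    by (cases "cproj V f = 0") (simp_all add: power2_eq_square)
qed

section \<open>Coercive forms\<close>

text \<open>By Cauchy-Schwarz for \<open>G\<close>, the functional \<open>w \<mapsto> G w u\<close>
  is bounded with a constant depending on \<open>u\<close> only. The resulting vectors supply both
  the adjoints in the fibres and the weak integrals.\<close>

lemma riesz_form:
  assumes "psd_form G" and bound: "\<And>u. Re (G u u) \<le> B * (norm u)\<^sup>2"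
  shows "\<exists>v. \<forall>g. cinner v g = G u g"
proof -
  interpret psd_form G by fact
  have "cmod (G w u) \<le> sqrt (B * Re (G u u)) * norm w" for w
  proof -
    have "(cmod (G w u))\<^sup>2 \<le> Re (G w w) * Re (G u u)"
      by (rule cauchy_schwarz)
    also have "\<dots> \<le> (B * (norm w)\<^sup>2) * Re (G u u)"
      by (intro mult_right_mono bound nonneg)
    finally have "cmod (G w u) \<le> sqrt (B * Re (G u u) * (norm w)\<^sup>2)"
      by (intro real_le_rsqrt) (simp add: algebra_simps)
    then show ?thesis
      by (simp add: real_sqrt_mult)
  qed
  moreover have "closed_csubspace (UNIV :: 'a set)"
    by (simp add: closed_csubspace_def csubspace_def)
  ultimately obtain v where "\<And>w. G w u = cinner w v"
    using riesz_csubspace[of UNIV "\<lambda>w. G w u" "sqrt (B * Re (G u u))"]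
    by (auto simp: add_left scale_left)
  then show ?thesis
    by (metis commute cinner_commute)
qed

text \<open>An abstract frame operator: \<open>T\<close> represents a form whose diagonal lies
  between the frame bounds \<open>A\<close> and \<open>B\<close>.\<close>

locale coercive_form = psd_form G for G :: "'h::chilbert_space \<Rightarrow> 'h \<Rightarrow> complex" +
  fixes T :: "'h \<Rightarrow> 'h" and A B :: real
  assumes represents: "cinner (T u) v = G u v"
    and pos: "0 < A"
    and lower: "A * (norm u)\<^sup>2 \<le> Re (G u u)"
    and upper: "Re (G u u) \<le> B * (norm u)\<^sup>2"
begin

definition T_inv :: "'h \<Rightarrow> 'h" where
  "T_inv = inv_into UNIV T"

lemma operator_add: "T (u + v) = T u + T v"
  by (rule cinner_eqI) (simp add: represents cinner_add_left add_left)

lemma operator_scaleC: "T (a *\<^sub>C u) = a *\<^sub>C T u"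
  by (rule cinner_eqI) (simp add: represents cinner_scaleC_left scale_left)

lemma operator_selfadjoint: "cinner (T u) v = cinner u (T v)"
  by (metis represents commute cinner_commute)

lemma norm_operator_ge: "A * norm u \<le> norm (T u)"
proof -
  have "A * (norm u)\<^sup>2 \<le> inner (T u) u"
    using lower[of u] by (simp flip: Re_cinner add: represents)
  also have "\<dots> \<le> norm (T u) * norm u"
    by (rule norm_cauchy_schwarz)
  finally show ?thesis
    by (cases "u = 0") (simp_all add: power2_eq_square)
qed

lemma norm_operator_le: "norm (T u) \<le> B * norm u"
proof (cases "u = 0")
  case True
  then show ?thesis
    using operator_add[of 0 0] by simp
next
  case False
  \<comment> \<open>The sign of \<open>B\<close> is read off from a nonzero vector.\<close>
  have "0 \<le> B * (norm u)\<^sup>2"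
    using upper[of u] nonneg[of u] by linarith
  then have B: "0 \<le> B"
    using False by (simp add: zero_le_mult_iff)
  \<comment> \<open>Cauchy-Schwarz for \<open>G\<close> at the pair \<open>u\<close>,
    \<open>T u\<close> bounds the operator norm by the same \<open>B\<close> that bounds the
    diagonal.\<close>
  have "((norm (T u))\<^sup>2)\<^sup>2 = (cmod (G u (T u)))\<^sup>2"
    by (simp add: cinner_self norm_power flip: represents)
  also have "\<dots> \<le> Re (G u u) * Re (G (T u) (T u))"
    by (rule cauchy_schwarz)
  also have "\<dots> \<le> (B * (norm u)\<^sup>2) * (B * (norm (T u))\<^sup>2)"
    by (intro mult_mono upper nonneg) (use B in auto)
  also have "\<dots> = (B * norm u * norm (T u))\<^sup>2"
    by (simp add: power2_eq_square)
  finally have "(norm (T u))\<^sup>2 \<le> B * norm u * norm (T u)"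
    by (rule power2_le_imp_le) (use B in simp)
  then show ?thesis
    using B by (cases "T u = 0") (simp_all add: power2_eq_square)
qed

lemma bounded_linear_operator: "bounded_linear T"
  by (rule bounded_linear_intro[where K = B])
    (simp_all add: operator_add scaleR_scaleC operator_scaleC norm_operator_le mult.commute)

text \<open>
  The range is closed because \<open>T\<close> is bounded below, and a vector \<open>v\<close> orthogonal to it
  satisfies \<open>G v v = 0\<close>.
\<close>

lemma bij_operator: "bij T"
proof (rule bijI)
  interpret bounded_linear T by (rule bounded_linear_operator)
  show "inj T"
  proof (rule injI)
    fix u v assume "T u = T v"
    then have "A * norm (u - v) \<le> 0"
      using norm_operator_ge[of "u - v"] by (simp add: diff)
    then show "u = v"
      using pos by (simp add: mult_le_0_iff)
  qed
  have "complete (range T)"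
    using complete_isometric_image[OF pos subspace_UNIV bounded_linear_operator]
      norm_operator_ge by (simp add: complete_UNIV)
  moreover have "subspace (range T)"
    by (intro linear_subspace_image subspace_UNIV bounded_linear.linear bounded_linear_operator)
  ultimately have V: "closed_csubspace (range T)"
    by (intro closed_csubspaceI complete_imp_closed)
      (auto simp flip: operator_scaleC)
  show "surj T"
  proof (intro surjI)
    fix y
    define v where "v = y - cproj (range T) y"
    have "G v v = 0"
      using cproj_orthogonal[OF V, of "T v" y] operator_selfadjoint[of v v] represents[of v v]
      by (simp add: v_def)
    then have "A * (norm v)\<^sup>2 \<le> 0"
      using lower[of v] by simp
    then have "y \<in> range T"
      using pos cproj_in[OF V, of y] by (simp add: mult_le_0_iff v_def)
    then show "T (inv_into UNIV T y) = y"
      by (rule f_inv_into_f)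
  qed
qed

lemma operator_inverse [simp]: "T (T_inv y) = y" "T_inv (T u) = u"
  using bij_operator by (simp_all add: T_inv_def bij_is_surj surj_f_inv_f bij_is_inj)

lemma inverse_selfadjoint: "cinner (T_inv u) v = cinner u (T_inv v)"
  using operator_selfadjoint[of "T_inv u" "T_inv v"] by simp

text \<open>The image under the inverse is a preimage under \<open>T\<close>, so continuity and
  linearity of \<open>T\<close> suffice.\<close>

lemma closed_csubspace_inverse_image:
  assumes V: "closed_csubspace V"
  shows "closed_csubspace (T_inv ` V)"
proof -
  have eq: "T_inv ` V = T -` V"
    by (metis bij_operator bij_vimage_eq_inv_image T_inv_def)
  have "closed (T -` V)"
    by (intro continuous_closed_vimage closed_csubspace_closed[OF V]
        linear_continuous_at bounded_linear_operator)
  moreover have "subspace (T -` V)"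
    by (intro linear_subspace_vimage closed_csubspace_subspace V bounded_linear.linear
        bounded_linear_operator)
  ultimately show ?thesis
    unfolding eq
    by (intro closed_csubspaceI) (simp_all add: operator_scaleC closed_csubspace_scaleC[OF V])
qed

lemma cproj_inverse_cproj:
  assumes V: "closed_csubspace V"
  shows "cproj V (T_inv (cproj (T_inv ` V) f)) = cproj V (T_inv f)"
proof (rule csubspace_orthogonal_unique[OF V])
  fix w assume w: "w \<in> V"
  have *: "cinner (cproj V (T_inv g)) w = cinner g (T_inv w)" for g
    using V w by (simp add: cinner_cproj_left inverse_selfadjoint)
  have "cinner (cproj V (T_inv (cproj (T_inv ` V) f))) w = cinner (cproj V (T_inv f)) w"
    using cinner_cproj_left[OF closed_csubspace_inverse_image[OF V]] w by (simp add: *)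
  then show "cinner w (cproj V (T_inv (cproj (T_inv ` V) f))) = cinner w (cproj V (T_inv f))"
    by (metis cinner_commute)
qed (use V cproj_in in auto)

end

section \<open>Operators into the fibres\<close>

lemma (in complex_hilbert_space) ip_nonneg:
  assumes "u \<in> carrier K"
  shows "0 \<le> Re (ip K u u)"
proof (cases "u = \<zero>")
  case True
  \<comment> \<open>\<open>ip_pos\<close> speaks of nonzero vectors; at zero, additivity is applied
    to \<open>\<zero> = \<zero> \<oplus> \<zero>\<close>.\<close>
  then have "ip K u u = 0"
    using ip_add_left[of u u u] assms by simp
  then show ?thesis
    by simp
qed (use ip_pos assms in force)

lemma (in complex_hilbert_space) ip_norm_power2:
  assumes "u \<in> carrier K"
  shows "(ip_norm K u)\<^sup>2 = Re (ip K u u)"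
  using ip_nonneg[OF assms] by (simp add: ip_norm_def)

locale fibre_operator = complex_hilbert_space K
  for K :: "('k, 'm) ip_space_scheme" (structure) +
  fixes V :: "'h::chilbert_space set" and T :: "'h \<Rightarrow> 'k"
  assumes V: "closed_csubspace V" and T: "bounded_operator_on V K T"
begin

text \<open>Precomposing with the projection makes the form total on the ambient space, so forms
  from different fibres can be integrated together.\<close>

definition form :: "'h \<Rightarrow> 'h \<Rightarrow> complex" where
  "form u v = ip K (T (cproj V u)) (T (cproj V v))"

lemma operator_carrier: "u \<in> V \<Longrightarrow> T u \<in> carrier K"
  using T by (auto simp: bounded_operator_on_def)

sublocale psd_form form
proof
  show "form (u + v) w = form u w + form v w" for u v w
    using T unfolding bounded_operator_on_def form_def
    by (simp add: V cproj_add cproj_in ip_add_left operator_carrier)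
  show "form (a *\<^sub>C u) v = a * form u v" for a u v
    using T unfolding bounded_operator_on_def form_def
    by (simp add: V cproj_scaleC cproj_in ip_smult_left operator_carrier)
  show "form v u = cnj (form u v)" for u v
    unfolding form_def by (intro ip_commute operator_carrier cproj_in V)
  show "0 \<le> Re (form u u)" for u
    unfolding form_def by (intro ip_nonneg operator_carrier cproj_in V)
qed

lemma Re_form: "Re (form u u) = (ip_norm K (T (cproj V u)))\<^sup>2"
  by (simp add: form_def ip_norm_power2 operator_carrier cproj_in V)

lemma form_bounded: "\<exists>C. \<forall>u. Re (form u u) \<le> C * (norm u)\<^sup>2"
proof -
  obtain C where C: "\<And>u. u \<in> V \<Longrightarrow> ip_norm K (T u) \<le> C * norm u"
    using T unfolding bounded_operator_on_def by blast
  have "Re (form u u) \<le> C\<^sup>2 * (norm u)\<^sup>2" for u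
  proof -
    have "0 \<le> ip_norm K (T (cproj V u))"
      using ip_nonneg[OF operator_carrier[OF cproj_in[OF V]]] by (simp add: ip_norm_def)
    then have "(ip_norm K (T (cproj V u)))\<^sup>2 \<le> (C * norm (cproj V u))\<^sup>2"
      by (intro power_mono C cproj_in V)
    also have "\<dots> \<le> C\<^sup>2 * (norm u)\<^sup>2"
      using norm_cproj_le[OF V] by (simp add: power_mult_distrib mult_left_mono power_mono)
    finally show ?thesis
      by (simp add: Re_form)
  qed
  then show ?thesis
    by blast
qed

text \<open>The adjoint is identified at the vectors \<open>T (cproj V u)\<close>: there it is the
  projection to \<open>V\<close> of the Riesz vector of \<open>form u\<close>.\<close>

lemma cinner_adjoint:
  "cinner (cproj V (adjoint_on V K T (T (cproj V u)))) g = form u g"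
proof -
  obtain C where "\<And>u. Re (form u u) \<le> C * (norm u)\<^sup>2"
    using form_bounded by blast
  then obtain v where v: "\<And>g. cinner v g = form u g"
    using riesz_form[OF psd_form_axioms] by blast
  have idem: "cproj V w = w" if "w \<in> V" for w
    using that by (intro cproj_unique V) (simp_all add: cinner_zero_left)
  have formV: "form w u = ip K (T w) (T (cproj V u))" if "w \<in> V" for w
    using idem[OF that] by (simp add: form_def)
  have *: "ip K (T w) (T (cproj V u)) = cinner w (cproj V v)" if "w \<in> V" for w
  proof -
    have "form w u = cnj (cinner v w)"
      by (simp add: v commute[of w u])
    also have "\<dots> = cnj (cinner (cproj V v) w)"
      by (simp add: cinner_cproj_left V that)
    finally show ?thesis
      by (simp add: formV that flip: cinner_commute)
  qed
  have "adjoint_on V K T (T (cproj V u)) = cproj V v"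
    unfolding adjoint_on_def
  proof (rule the_equality)
    show "cproj V v \<in> V \<and> (\<forall>w\<in>V. ip K (T w) (T (cproj V u)) = cinner w (cproj V v))"
      using * cproj_in[OF V] by blast
    show "z = cproj V v"
      if "z \<in> V \<and> (\<forall>w\<in>V. ip K (T w) (T (cproj V u)) = cinner w z)" for z
      by (rule csubspace_orthogonal_unique[OF V]) (use that * cproj_in[OF V] in auto)
  qed
  then have "cinner (cproj V (adjoint_on V K T (T (cproj V u)))) g = cinner v (cproj V g)"
    by (simp add: idem cproj_in V cinner_cproj_commute)
  also have "\<dots> = form u g"
    by (simp add: v form_def idem cproj_in V)
  finally show ?thesis .
qed

end

section \<open>The frame operator\<close>

lemma set_integral_cnj:
  "(LINT x:Y|M. cnj (f x)) = cnj (LINT x:Y|M. f x)"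
proof -
  have "(LINT x:Y|M. cnj (f x)) = (LINT x|M. cnj (indicator Y x *\<^sub>R f x))"
    by (simp add: set_lebesgue_integral_def complex_cnj_scaleR)
  then show ?thesis
    by (simp only: Bochner_Integration.integral_cnj set_lebesgue_integral_def)
qed

lemma has_weak_integral_cong:
  assumes "Y \<in> sets M" "\<And>x. x \<in> Y \<Longrightarrow> u x = v x"
  shows "has_weak_integral M Y u = has_weak_integral M Y v"
proof -
  have "set_integrable M Y (\<lambda>x. cinner (u x) g) = set_integrable M Y (\<lambda>x. cinner (v x) g)"
    "(LINT x:Y|M. cinner (u x) g) = (LINT x:Y|M. cinner (v x) g)" for g
    by (rule set_integrable_cong set_lebesgue_integral_cong; simp add: assms)+
  then show ?thesis
    by (simp add: has_weak_integral_def fun_eq_iff)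
qed

lemma weak_integral_eqI:
  assumes "has_weak_integral M Y u v"
  shows "weak_integral M Y u = v"
  unfolding weak_integral_def
proof (rule the_equality)
  show "has_weak_integral M Y u v"
    by (rule assms)
  show "w = v" if "has_weak_integral M Y u w" for w
    by (rule cinner_eqI) (use assms that in \<open>simp add: has_weak_integral_def\<close>)
qed

context continuous_g_fusion_frame
begin

definition integrand :: "'x \<Rightarrow> 'h \<Rightarrow> 'h \<Rightarrow> complex" where
  "integrand x u v = complex_of_real ((\<omega> x)\<^sup>2) *
     ip (H x) (\<Lambda> x (cproj (F x) u)) (\<Lambda> x (cproj (F x) v))"

lemma fibre:
  assumes "x \<in> space M"
  shows "fibre_operator (H x) (F x) (\<Lambda> x)"
  using assms hilbert closed_csubspace bounded_operator
  by (simp add: fibre_operator_def fibre_operator_axioms_def)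

lemma integrand_psd:
  assumes x: "x \<in> space M"
  shows "psd_form (integrand x)"
proof -
  interpret fibre_operator "H x" "F x" "\<Lambda> x"
    by (rule fibre[OF x])
  have eq: "integrand x u v = complex_of_real ((\<omega> x)\<^sup>2) * form u v" for u v
    by (simp add: integrand_def form_def)
  show ?thesis
  proof
    show "integrand x v u = cnj (integrand x u v)" for u v
      by (simp add: eq commute[of v u])
    show "0 \<le> Re (integrand x u u)" for u
      using nonneg[of u] by (simp add: eq)
  qed (simp_all add: eq add_left scale_left algebra_simps)
qed

lemma Re_integrand:
  assumes x: "x \<in> space M"
  shows "Re (integrand x u u) = (\<omega> x)\<^sup>2 * (ip_norm (H x) (\<Lambda> x (cproj (F x) u)))\<^sup>2"
proof -
  interpret fibre_operator "H x" "F x" "\<Lambda> x"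
    by (rule fibre[OF x])
  show ?thesis
    using Re_form[of u] by (simp add: integrand_def form_def)
qed

text \<open>The diagonal is nonnegative and measurable by assumption, and the upper frame bound
  makes its integral finite.\<close>

lemma integrable_Re_integrand: "integrable M (\<lambda>x. Re (integrand x u u))"
proof -
  let ?N = "\<lambda>x. (\<omega> x)\<^sup>2 * (ip_norm (H x) (\<Lambda> x (cproj (F x) u)))\<^sup>2"
  have "?N \<in> borel_measurable M"
    by (intro borel_measurable_times borel_measurable_power weight_measurable norm_measurable)
  moreover have "(\<integral>\<^sup>+x. ennreal (?N x) \<partial>M) < \<infinity>"
    using frame_bounds by (metis (no_types, lifting) ennreal_less_top order_le_less_trans
        infinity_ennreal_def)
  ultimately have "integrable M ?N"
    by (intro integrableI_nonneg) auto
  then show ?thesis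
    by (simp cong: Bochner_Integration.integrable_cong add: Re_integrand)
qed

text \<open>Polarization reduces this to four diagonal terms, so measurability of the squared norms
  is enough.\<close>

lemma integrable_integrand: "integrable M (\<lambda>x. integrand x u v)"
proof -
  have "integrable M (\<lambda>x.
      (complex_of_real (Re (integrand x (u + 1 *\<^sub>C v) (u + 1 *\<^sub>C v)))
      - complex_of_real (Re (integrand x (u + (-1) *\<^sub>C v) (u + (-1) *\<^sub>C v)))
      + \<i> * complex_of_real (Re (integrand x (u + \<i> *\<^sub>C v) (u + \<i> *\<^sub>C v)))
      - \<i> * complex_of_real (Re (integrand x (u + (-\<i>) *\<^sub>C v) (u + (-\<i>) *\<^sub>C v)))) / 4)"
    by (intro integrable_divide Bochner_Integration.integrable_diff
        Bochner_Integration.integrable_add integrable_mult_right integrable_of_real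
        integrable_Re_integrand)
  then show ?thesis
    by (simp only: psd_form.polarization[OF integrand_psd, of _ u v]
        cong: Bochner_Integration.integrable_cong)
qed

lemma set_integrable_integrand:
  "Y \<in> sets M \<Longrightarrow> set_integrable M Y (\<lambda>x. integrand x u v)"
  using set_integrable_subset[of M "space M" "\<lambda>x. integrand x u v" Y]
    integrable_integrand[of u v] sets.sets_into_space[of Y M]
  by (simp add: set_integrable_def integrable_mult_indicator)

definition integrated_form :: "'x set \<Rightarrow> 'h \<Rightarrow> 'h \<Rightarrow> complex" where
  "integrated_form Y u v = (LINT x:Y|M. integrand x u v)"

lemma Re_integrated_form:
  assumes "Y \<in> sets M"
  shows "Re (integrated_form Y u u) = (LINT x|M. indicator Y x * Re (integrand x u u))"
proof -
  have "integrable M (\<lambda>x. indicator Y x *\<^sub>R integrand x u u)"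
    using set_integrable_integrand[OF assms] by (simp add: set_integrable_def)
  then show ?thesis
    unfolding integrated_form_def set_lebesgue_integral_def
    by (subst integral_Re[symmetric]) auto
qed

lemma integrated_form_psd:
  assumes Y: "Y \<in> sets M"
  shows "psd_form (integrated_form Y)"
proof
  have space: "x \<in> space M" if "x \<in> Y" for x
    using that Y sets.sets_into_space by blast
  show "integrated_form Y (u + v) w = integrated_form Y u w + integrated_form Y v w" for u v w
  proof -
    have "integrated_form Y (u + v) w = (LINT x:Y|M. integrand x u w + integrand x v w)"
      unfolding integrated_form_def
      by (intro set_lebesgue_integral_cong Y)
        (simp add: space psd_form.add_left[OF integrand_psd])
    then show ?thesis
      by (simp add: integrated_form_def set_integrable_integrand Y)
  qed
  show "integrated_form Y (a *\<^sub>C u) v = a * integrated_form Y u v" for a u v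
  proof -
    have "integrated_form Y (a *\<^sub>C u) v = (LINT x:Y|M. a * integrand x u v)"
      unfolding integrated_form_def
      by (intro set_lebesgue_integral_cong Y)
        (simp add: space psd_form.scale_left[OF integrand_psd])
    then show ?thesis
      by (simp add: integrated_form_def)
  qed
  show "integrated_form Y v u = cnj (integrated_form Y u v)" for u v
  proof -
    have "integrated_form Y v u = (LINT x:Y|M. cnj (integrand x u v))"
      unfolding integrated_form_def
      by (intro set_lebesgue_integral_cong Y)
        (simp add: space psd_form.commute[OF integrand_psd, of _ v u])
    then show ?thesis
      by (simp add: integrated_form_def set_integral_cnj)
  qed
  show "0 \<le> Re (integrated_form Y u u)" for u
    unfolding Re_integrated_form[OF Y]
    by (intro Bochner_Integration.integral_nonneg)
      (simp add: psd_form.nonneg[OF integrand_psd] split: split_indicator)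
qed

text \<open>Shrinking the domain of a nonnegative diagonal only decreases the integral, so one
  \<open>B\<close> serves every \<open>Y\<close>; the lower bound concerns the whole space.\<close>

lemma integrated_form_bounds:
  obtains A B where "0 < A"
    "\<And>u. A * (norm u)\<^sup>2 \<le> Re (integrated_form (space M) u u)"
    "\<And>u Y. Y \<in> sets M \<Longrightarrow> Re (integrated_form Y u u) \<le> B * (norm u)\<^sup>2"
proof -
  obtain A B where AB: "0 < A" "A \<le> B" and
    bounds: "\<And>f. ennreal (A * (norm f)\<^sup>2)
                \<le> (\<integral>\<^sup>+x. ennreal ((\<omega> x)\<^sup>2 * (ip_norm (H x) (\<Lambda> x (cproj (F x) f)))\<^sup>2) \<partial>M)"
      "\<And>f. (\<integral>\<^sup>+x. ennreal ((\<omega> x)\<^sup>2 * (ip_norm (H x) (\<Lambda> x (cproj (F x) f)))\<^sup>2) \<partial>M)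
                \<le> ennreal (B * (norm f)\<^sup>2)"
    using frame_bounds by blast
  have nonneg: "0 \<le> Re (integrand x u u)" if "x \<in> space M" for x u
    using psd_form.nonneg[OF integrand_psd[OF that]] .
  have int: "(LINT x|M. indicator (space M) x * Re (integrand x u u))
      = (LINT x|M. Re (integrand x u u))" for u
    by (intro Bochner_Integration.integral_cong) auto
  have nn: "(\<integral>\<^sup>+x. ennreal ((\<omega> x)\<^sup>2 * (ip_norm (H x) (\<Lambda> x (cproj (F x) u)))\<^sup>2) \<partial>M)
      = ennreal (Re (integrated_form (space M) u u))" for u
  proof -
    have "(\<integral>\<^sup>+x. ennreal ((\<omega> x)\<^sup>2 * (ip_norm (H x) (\<Lambda> x (cproj (F x) u)))\<^sup>2) \<partial>M)
        = (\<integral>\<^sup>+x. ennreal (Re (integrand x u u)) \<partial>M)"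
      by (intro nn_integral_cong) (simp add: Re_integrand)
    also have "\<dots> = ennreal (LINT x|M. Re (integrand x u u))"
      by (intro nn_integral_eq_integral integrable_Re_integrand AE_I2 nonneg)
    finally show ?thesis
      by (simp add: Re_integrated_form int)
  qed
  have form_nonneg: "0 \<le> Re (integrated_form (space M) u u)" for u
    by (rule psd_form.nonneg[OF integrated_form_psd]) simp
  show thesis
  proof (rule that[OF \<open>0 < A\<close>])
    show "A * (norm u)\<^sup>2 \<le> Re (integrated_form (space M) u u)" for u
      using bounds(1)[of u] unfolding nn by (simp add: form_nonneg)
    show "Re (integrated_form Y u u) \<le> B * (norm u)\<^sup>2" if Y: "Y \<in> sets M" for u Y
    proof -
      have "Re (integrated_form Y u u) \<le> Re (integrated_form (space M) u u)"
        unfolding Re_integrated_form[OF Y] Re_integrated_form[OF sets.top] int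
        using integrable_mult_indicator[OF Y integrable_Re_integrand[of u]]
        by (intro integral_mono integrable_Re_integrand)
          (auto simp: nonneg split: split_indicator)
      also have "\<dots> \<le> B * (norm u)\<^sup>2"
        using bounds(2)[of u] AB unfolding nn by (simp add: ennreal_le_iff)
      finally show ?thesis .
    qed
  qed
qed

definition restricted_operator :: "'x set \<Rightarrow> 'h \<Rightarrow> 'h" where
  "restricted_operator Y u = weak_integral M Y
     (\<lambda>x. (\<omega> x)\<^sup>2 *\<^sub>R cproj (F x) (adjoint_on (F x) (H x) (\<Lambda> x) (\<Lambda> x (cproj (F x) u))))"

text \<open>The Riesz vector of the integrated form is a weak integral because the fibre adjoint
  identity matches the integrands pointwise. This existence gives meaning to the description in
  \<open>weak_integral\<close>.\<close>

lemma cinner_restricted_operator: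
  assumes Y: "Y \<in> sets M"
  shows "cinner (restricted_operator Y u) g = integrated_form Y u g"
proof -
  let ?w = "\<lambda>x. (\<omega> x)\<^sup>2 *\<^sub>R cproj (F x) (adjoint_on (F x) (H x) (\<Lambda> x) (\<Lambda> x (cproj (F x) u)))"
  obtain B where "\<And>u. Re (integrated_form Y u u) \<le> B * (norm u)\<^sup>2"
    using integrated_form_bounds Y by metis
  then obtain v where v: "\<And>g. cinner v g = integrated_form Y u g"
    using riesz_form[OF integrated_form_psd[OF Y]] by blast
  have eq: "cinner (?w x) g = integrand x u g" if "x \<in> Y" for x g
  proof -
    interpret fibre_operator "H x" "F x" "\<Lambda> x"
      using that Y sets.sets_into_space by (intro fibre) blast
    show ?thesis
      by (simp only: cinner_scaleR_left cinner_adjoint form_def integrand_def)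
  qed
  have "has_weak_integral M Y ?w v"
    unfolding has_weak_integral_def
  proof (intro allI conjI)
    fix g
    show "set_integrable M Y (\<lambda>x. cinner (?w x) g)"
      using set_integrable_integrand[OF Y, of u g] eq
      by (subst set_integrable_cong[OF refl refl eq])
    show "(LINT x:Y|M. cinner (?w x) g) = cinner v g"
      unfolding v integrated_form_def by (intro set_lebesgue_integral_cong Y) (simp add: eq)
  qed
  then have "restricted_operator Y u = v"
    unfolding restricted_operator_def by (rule weak_integral_eqI)
  then show ?thesis
    by (simp add: v)
qed

lemma frame_operator_coercive:
  "\<exists>A B. coercive_form (integrated_form (space M)) (frame_operator M \<omega> F H \<Lambda>) A B"
proof -
  obtain A B where AB: "0 < A"
    "\<And>u. A * (norm u)\<^sup>2 \<le> Re (integrated_form (space M) u u)"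
    "\<And>u Y. Y \<in> sets M \<Longrightarrow> Re (integrated_form Y u u) \<le> B * (norm u)\<^sup>2"
    using integrated_form_bounds by blast
  interpret psd_form "integrated_form (space M)"
    by (rule integrated_form_psd) simp
  have "coercive_form (integrated_form (space M)) (frame_operator M \<omega> F H \<Lambda>) A B"
  proof
    show "cinner (frame_operator M \<omega> F H \<Lambda> u) v = integrated_form (space M) u v" for u v
      using cinner_restricted_operator[of "space M" u v]
      by (simp add: frame_operator_def restricted_operator_def)
  qed (use AB in auto)
  then show ?thesis
    by blast
qed

lemma dual_operator_cproj:
  assumes "x \<in> space M"
  shows "dual_operator M \<omega> F H \<Lambda> x (cproj (dual_subspace M \<omega> F H \<Lambda> x) f)
    = \<Lambda> x (cproj (F x) (frame_operator_inv M \<omega> F H \<Lambda> f))"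
proof -
  obtain A B where "coercive_form (integrated_form (space M)) (frame_operator M \<omega> F H \<Lambda>) A B"
    using frame_operator_coercive by blast
  then interpret coercive_form "integrated_form (space M)" "frame_operator M \<omega> F H \<Lambda>" A B .
  have "frame_operator_inv M \<omega> F H \<Lambda> = T_inv"
    by (simp add: frame_operator_inv_def T_inv_def)
  then show ?thesis
    using cproj_inverse_cproj[OF closed_csubspace[OF assms]]
    by (simp add: dual_operator_def dual_subspace_def)
qed

text \<open>The dual projection is absorbed by \<open>dual_operator_cproj\<close>, so the integrands
  agree on \<open>Y\<close>.\<close>

lemma partial_frame_operator_eq:
  assumes Y: "Y \<in> sets M"
  shows "partial_frame_operator M \<omega> F H \<Lambda> Y f
    = restricted_operator Y (frame_operator_inv M \<omega> F H \<Lambda> f)"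
  unfolding partial_frame_operator_def restricted_operator_def weak_integral_def
  using Y sets.sets_into_space[OF Y]
  by (subst has_weak_integral_cong[OF Y]) (auto simp: dual_operator_cproj)

lemma cinner_partial_frame_operator:
  assumes Y: "Y \<in> sets M"
  shows "(LINT x:Y|M. complex_of_real ((\<omega> x)\<^sup>2) *
        ip (H x) (dual_operator M \<omega> F H \<Lambda> x (cproj (dual_subspace M \<omega> F H \<Lambda> x) f))
          (\<Lambda> x (cproj (F x) g)))
    = cinner (partial_frame_operator M \<omega> F H \<Lambda> Y f) g"
proof -
  have "x \<in> space M" if "x \<in> Y" for x
    using that Y sets.sets_into_space by blast
  then show ?thesis
    unfolding partial_frame_operator_eq[OF Y] cinner_restricted_operator[OF Y] integrated_form_def
    by (intro set_lebesgue_integral_cong Y) (simp add: integrand_def dual_operator_cproj)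
qed

text \<open>The two integrated forms add up to the full form at the preimage of \<open>f\<close>
  under the frame operator, which is \<open>cinner f g\<close>.\<close>

lemma partial_frame_operator_complement:
  assumes Y: "Y \<in> sets M"
  shows "partial_frame_operator M \<omega> F H \<Lambda> Y f + partial_frame_operator M \<omega> F H \<Lambda> (space M - Y) f = f"
proof (rule cinner_eqI)
  fix g
  obtain A B where "coercive_form (integrated_form (space M)) (frame_operator M \<omega> F H \<Lambda>) A B"
    using frame_operator_coercive by blast
  then interpret coercive_form "integrated_form (space M)" "frame_operator M \<omega> F H \<Lambda>" A B .
  let ?u = "frame_operator_inv M \<omega> F H \<Lambda> f"
  have Yc: "space M - Y \<in> sets M"
    using Y by blast
  have u: "?u = T_inv f"
    by (simp add: frame_operator_inv_def T_inv_def)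
  have "integrated_form Y ?u g + integrated_form (space M - Y) ?u g
      = integrated_form (Y \<union> (space M - Y)) ?u g"
    unfolding integrated_form_def
    by (subst set_integral_Un) (auto intro: set_integrable_integrand Y Yc)
  also have "Y \<union> (space M - Y) = space M"
    using Y sets.sets_into_space by blast
  also have "integrated_form (space M) ?u g = cinner f g"
    using represents[of ?u g] by (simp add: u)
  finally show "cinner (partial_frame_operator M \<omega> F H \<Lambda> Y f
      + partial_frame_operator M \<omega> F H \<Lambda> (space M - Y) f) g = cinner f g"
    by (simp add: partial_frame_operator_eq cinner_restricted_operator cinner_add_left Y Yc)
qed

end

theorem theorem3p1:
  fixes M :: "'x measure"
    and \<omega> :: "'x \<Rightarrow> real"
    and F :: "'x \<Rightarrow> 'h::chilbert_space set"
    and H :: "'x \<Rightarrow> 'k ip_space"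
    and \<Lambda> :: "'x \<Rightarrow> 'h \<Rightarrow> 'k"
    and X1 :: "'x set"
    and f :: 'h
  assumes "continuous_g_fusion_frame M \<omega> F H \<Lambda>"
    and "X1 \<in> sets M"
  shows
    "(LINT x:X1|M. complex_of_real ((\<omega> x)\<^sup>2) *
        ip (H x) (dual_operator M \<omega> F H \<Lambda> x (cproj (dual_subspace M \<omega> F H \<Lambda> x) f))
          (\<Lambda> x (cproj (F x) f)))
      - complex_of_real ((norm (partial_frame_operator M \<omega> F H \<Lambda> X1 f))\<^sup>2)
     = (LINT x:(space M - X1)|M. complex_of_real ((\<omega> x)\<^sup>2) *
        cnj (ip (H x) (dual_operator M \<omega> F H \<Lambda> x (cproj (dual_subspace M \<omega> F H \<Lambda> x) f))
          (\<Lambda> x (cproj (F x) f))))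
      - complex_of_real ((norm (partial_frame_operator M \<omega> F H \<Lambda> (space M - X1) f))\<^sup>2)"
proof -
  interpret continuous_g_fusion_frame M \<omega> F H \<Lambda>
    by fact
  let ?P = "partial_frame_operator M \<omega> F H \<Lambda> X1 f"
  let ?Q = "partial_frame_operator M \<omega> F H \<Lambda> (space M - X1) f"
  let ?h = "\<lambda>x. complex_of_real ((\<omega> x)\<^sup>2) *
        ip (H x) (dual_operator M \<omega> F H \<Lambda> x (cproj (dual_subspace M \<omega> F H \<Lambda> x) f))
          (\<Lambda> x (cproj (F x) f))"
  have Xc: "space M - X1 \<in> sets M"
    using assms(2) by blast
  have f: "?P + ?Q = f"
    by (rule partial_frame_operator_complement[OF assms(2)])
  \<comment> \<open>The weight is real, so conjugation passes outside the integral. Writing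
    \<open>f\<close> as \<open>?P + ?Q\<close> leaves \<open>cinner ?P ?Q\<close> once
    \<open>norm ?Q\<close> squared is subtracted.\<close>
  have "(LINT x:(space M - X1)|M. complex_of_real ((\<omega> x)\<^sup>2) *
        cnj (ip (H x) (dual_operator M \<omega> F H \<Lambda> x (cproj (dual_subspace M \<omega> F H \<Lambda> x) f))
          (\<Lambda> x (cproj (F x) f)))) = cnj (LINT x:(space M - X1)|M. ?h x)"
    by (simp flip: set_integral_cnj)
  also have "\<dots> = cnj (cinner ?Q f)"
    by (simp only: cinner_partial_frame_operator[OF Xc])
  also have "\<dots> = cinner (?P + ?Q) ?Q"
    using f by (simp flip: cinner_commute)
  finally have conj: "(LINT x:(space M - X1)|M. complex_of_real ((\<omega> x)\<^sup>2) *
        cnj (ip (H x) (dual_operator M \<omega> F H \<Lambda> x (cproj (dual_subspace M \<omega> F H \<Lambda> x) f))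
          (\<Lambda> x (cproj (F x) f)))) = cinner ?P ?Q + cinner ?Q ?Q"
    by (simp only: cinner_add_left)
  \<comment> \<open>The same splitting, now in the second slot, leaves the same cross term
    \<open>cinner ?P ?Q\<close>.\<close>
  have "(LINT x:X1|M. ?h x) = cinner ?P (?P + ?Q)"
    unfolding f by (rule cinner_partial_frame_operator[OF assms(2)])
  also have "\<dots> = cinner ?P ?P + cinner ?P ?Q"
    by (rule cinner_add_right)
  finally show ?thesis
    unfolding conj by (simp add: cinner_self)
qed

end
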